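(* Let $\alpha,\beta\in\mathbb{Z}$, let $A_1\in\{1,-1\}$ and let $A_2,A_3,A_4$ be non-zero integers. Let $(A_n)_{n\in\mathbb{Z}}$ be the Somos 4 sequence defined by $$A_{n+4}A_n=\alpha\,A_{n+3}A_{n+1}+\beta\,(A_{n+2})^2$$ with initial values $A_1,A_2,A_3,A_4$, and put $$T=\frac{A_1^2A_4^2+\alpha\,(A_2^3A_4+A_1A_3^3)+\beta\,A_2^2A_3^2}{A_1A_2A_3A_4}.$$ If $\beta T\in\mathbb{Z}$, then $A_n\in\mathbb{Z}$ for all $n\ge1$. If, furthermore, the backward iterates $A_0,A_{-1},A_{-2}$ are integers, then $A_n\in\mathbb{Z}$ for all $n\in\mathbb{Z}$.
   Context: The recurrence is iterated forwards and backwards from the four non-zero values $A_1,\dots,A_4$, giving a sequence indexed by $\mathbb{Z}$. Convention on zeros: if a zero term is encountered, the sequence is analytically continued through it. That is, $A_n$ is by definition the value at the given data of the rational function of $\alpha,\beta,A_1,A_2,A_3,A_4$ obtained by iterating the recurrence formally with these six quantities as indeterminates; it is known (the Laurent property of Fomin and Zelevinsky) that this rational function lies in $\mathbb{Z}[\alpha,\beta,A_1^{\pm1},A_2^{\pm1},A_3^{\pm1},A_4^{\pm1}]$, so its value is well defined whenever $A_1,A_2,A_3,A_4$ are non-zero. *)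

theory Defs
  imports Complex_Main "HOL-Computational_Algebra.Computational_Algebra"
begin

text \<open>
  Polynomials over the integers in the six indeterminates
  \<open>\<alpha>, \<beta>, A\<^sub>1, A\<^sub>2, A\<^sub>3, A\<^sub>4\<close>, as iterated univariate polynomials: \<open>\<alpha>\<close> is the
  outermost indeterminate, \<open>A\<^sub>4\<close> the innermost one.
\<close>

type_synonym zpoly6 = "int poly poly poly poly poly poly"

definition var_alpha :: zpoly6 where "var_alpha = [:0, 1:]"
definition var_beta :: zpoly6 where "var_beta = [:[:0, 1:]:]"
definition var_A1 :: zpoly6 where "var_A1 = [:[:[:0, 1:]:]:]"
definition var_A2 :: zpoly6 where "var_A2 = [:[:[:[:0, 1:]:]:]:]"
definition var_A3 :: zpoly6 where "var_A3 = [:[:[:[:[:0, 1:]:]:]:]:]"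
definition var_A4 :: zpoly6 where "var_A4 = [:[:[:[:[:[:0, 1:]:]:]:]:]:]"

definition eval6 :: "int \<Rightarrow> int \<Rightarrow> int \<Rightarrow> int \<Rightarrow> int \<Rightarrow> int \<Rightarrow> zpoly6 \<Rightarrow> int" where
  "eval6 \<alpha> \<beta> a1 a2 a3 a4 p =
     poly (poly (poly (poly (poly (poly p (of_int \<alpha>)) (of_int \<beta>)) (of_int a1)) (of_int a2))
       (of_int a3)) a4"

lemma eval6_simps [simp]:
  "eval6 \<alpha> \<beta> a1 a2 a3 a4 0 = 0"
  "eval6 \<alpha> \<beta> a1 a2 a3 a4 1 = 1"
  "eval6 \<alpha> \<beta> a1 a2 a3 a4 (p + q) = eval6 \<alpha> \<beta> a1 a2 a3 a4 p + eval6 \<alpha> \<beta> a1 a2 a3 a4 q"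
  "eval6 \<alpha> \<beta> a1 a2 a3 a4 (p * q) = eval6 \<alpha> \<beta> a1 a2 a3 a4 p * eval6 \<alpha> \<beta> a1 a2 a3 a4 q"
  "eval6 \<alpha> \<beta> a1 a2 a3 a4 (p ^ n) = eval6 \<alpha> \<beta> a1 a2 a3 a4 p ^ n"
  by (simp_all add: eval6_def poly_power)

lemma poly_of_int_embed: "poly (of_int k :: 'a::comm_ring_1 poly) x = of_int k"
  by (simp add: of_int_poly)

lemma eval6_vars [simp]:
  "eval6 \<alpha> \<beta> a1 a2 a3 a4 var_alpha = \<alpha>"
  "eval6 \<alpha> \<beta> a1 a2 a3 a4 var_beta = \<beta>"
  "eval6 \<alpha> \<beta> a1 a2 a3 a4 var_A1 = a1"
  "eval6 \<alpha> \<beta> a1 a2 a3 a4 var_A2 = a2"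
  "eval6 \<alpha> \<beta> a1 a2 a3 a4 var_A3 = a3"
  "eval6 \<alpha> \<beta> a1 a2 a3 a4 var_A4 = a4"
  by (simp_all add: eval6_def var_alpha_def var_beta_def var_A1_def var_A2_def var_A3_def
      var_A4_def poly_of_int_embed)

text \<open>
  A rational function has a value at a point if it can be written as a quotient of polynomials
  whose denominator does not vanish there.
\<close>

definition has_value6 ::
  "zpoly6 fract \<Rightarrow> int \<Rightarrow> int \<Rightarrow> int \<Rightarrow> int \<Rightarrow> int \<Rightarrow> int \<Rightarrow> rat \<Rightarrow> bool" where
  "has_value6 r \<alpha> \<beta> a1 a2 a3 a4 v \<longleftrightarrow>
     (\<exists>p q. r = Fract p q \<and> eval6 \<alpha> \<beta> a1 a2 a3 a4 q \<noteq> 0 \<and>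
       v = of_int (eval6 \<alpha> \<beta> a1 a2 a3 a4 p) / of_int (eval6 \<alpha> \<beta> a1 a2 a3 a4 q))"

lemma has_value6_unique:
  assumes "has_value6 r \<alpha> \<beta> a1 a2 a3 a4 v" and "has_value6 r \<alpha> \<beta> a1 a2 a3 a4 w"
  shows "v = w"
proof -
  let ?e = "eval6 \<alpha> \<beta> a1 a2 a3 a4"
  obtain p q p' q' where r: "r = Fract p q" "r = Fract p' q'"
    and q: "?e q \<noteq> 0" "?e q' \<noteq> 0"
    and v: "v = of_int (?e p) / of_int (?e q)" and w: "w = of_int (?e p') / of_int (?e q')"
    using assms unfolding has_value6_def by blast
  have "q \<noteq> 0" "q' \<noteq> 0" using q by auto
  then have "p * q' = p' * q" using r by (simp add: eq_fract)
  then have "?e p * ?e q' = ?e p' * ?e q" by (metis eval6_simps(4))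
  then have "(of_int (?e p) :: rat) * of_int (?e q') = of_int (?e p') * of_int (?e q)"
    by (metis of_int_mult)
  then show ?thesis using q v w by (simp add: frac_eq_eq)
qed

text \<open>
  The recurrence as a map on windows of four consecutive terms, solved for the next and for the
  preceding term, respectively.
\<close>

fun somos4_fwd :: "'a::field \<Rightarrow> 'a \<Rightarrow> 'a \<times> 'a \<times> 'a \<times> 'a \<Rightarrow> 'a \<times> 'a \<times> 'a \<times> 'a" where
  "somos4_fwd \<alpha> \<beta> (w, x, y, z) = (x, y, z, (\<alpha> * z * x + \<beta> * y\<^sup>2) / w)"

fun somos4_bwd :: "'a::field \<Rightarrow> 'a \<Rightarrow> 'a \<times> 'a \<times> 'a \<times> 'a \<Rightarrow> 'a \<times> 'a \<times> 'a \<times> 'a" where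
  "somos4_bwd \<alpha> \<beta> (w, x, y, z) = ((\<alpha> * y * w + \<beta> * x\<^sup>2) / z, w, x, y)"

text \<open>The window starting at index \<open>n\<close>, for the recurrence with indeterminate data.\<close>

definition somos4_window ::
  "int \<Rightarrow> zpoly6 fract \<times> zpoly6 fract \<times> zpoly6 fract \<times> zpoly6 fract" where
  "somos4_window n =
     (let init = (to_fract var_A1, to_fract var_A2, to_fract var_A3, to_fract var_A4) in
      if n \<ge> 1 then (somos4_fwd (to_fract var_alpha) (to_fract var_beta) ^^ nat (n - 1)) init
      else (somos4_bwd (to_fract var_alpha) (to_fract var_beta) ^^ nat (1 - n)) init)"

definition somos4_formal :: "int \<Rightarrow> zpoly6 fract" where
  "somos4_formal n = fst (somos4_window n)"

text \<open>
  The Somos 4 sequence of given data. By the Laurent property the value exists whenever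
  \<open>A\<^sub>1, A\<^sub>2, A\<^sub>3, A\<^sub>4\<close> are non-zero; no division by a zero term of the sequence takes place.
\<close>

definition somos4 :: "int \<Rightarrow> int \<Rightarrow> int \<Rightarrow> int \<Rightarrow> int \<Rightarrow> int \<Rightarrow> int \<Rightarrow> rat" where
  "somos4 \<alpha> \<beta> a1 a2 a3 a4 n = (THE v. has_value6 (somos4_formal n) \<alpha> \<beta> a1 a2 a3 a4 v)"

text \<open>
  The formal terms are non-zero, because they have positive values at the all-ones point. Hence
  every division above is genuine and the formal sequence satisfies the recurrence on all of
  \<open>\<int>\<close>.
\<close>

definition pos_at_ones :: "zpoly6 fract \<Rightarrow> bool" where
  "pos_at_ones r \<longleftrightarrow>
     (\<exists>p q. r = Fract p q \<and> eval6 1 1 1 1 1 1 p > 0 \<and> eval6 1 1 1 1 1 1 q > 0)"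

lemma pos_at_ones_nonzero: "pos_at_ones r \<Longrightarrow> r \<noteq> 0"
proof -
  assume "pos_at_ones r"
  then obtain p q where r: "r = Fract p q" and "eval6 1 1 1 1 1 1 p > 0" "eval6 1 1 1 1 1 1 q > 0"
    unfolding pos_at_ones_def by blast
  then have "p \<noteq> 0" "q \<noteq> 0" by auto
  then show "r \<noteq> 0" using r by (simp add: Zero_fract_def eq_fract)
qed

lemma pos_at_ones_ops:
  assumes "pos_at_ones r" "pos_at_ones s"
  shows "pos_at_ones (r + s)" "pos_at_ones (r * s)" "pos_at_ones (r / s)"
proof -
  let ?e = "eval6 1 1 1 1 1 1"
  obtain p q p' q' where r: "r = Fract p q" "?e p > 0" "?e q > 0"
    and s: "s = Fract p' q'" "?e p' > 0" "?e q' > 0"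
    using assms unfolding pos_at_ones_def by blast
  have nz: "q \<noteq> 0" "q' \<noteq> 0" using r s by auto
  show "pos_at_ones (r + s)" unfolding pos_at_ones_def
    by (rule exI[of _ "p * q' + p' * q"], rule exI[of _ "q * q'"]) (use r s nz in \<open>simp add: add_pos_pos\<close>)
  show "pos_at_ones (r * s)" unfolding pos_at_ones_def
    by (rule exI[of _ "p * p'"], rule exI[of _ "q * q'"]) (use r s in simp)
  show "pos_at_ones (r / s)" unfolding pos_at_ones_def
    by (rule exI[of _ "p * q'"], rule exI[of _ "q * p'"]) (use r s in simp)
qed

lemma pos_at_ones_to_fract: "eval6 1 1 1 1 1 1 p > 0 \<Longrightarrow> pos_at_ones (to_fract p)"
  unfolding pos_at_ones_def to_fract_def by (rule exI[of _ p], rule exI[of _ 1]) simp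

lemma somos4_window_Suc:
  assumes "n \<ge> 1"
  shows "somos4_window (n + 1) =
    somos4_fwd (to_fract var_alpha) (to_fract var_beta) (somos4_window n)"
proof -
  have "nat n = Suc (nat (n - 1))" using assms by linarith
  then show ?thesis using assms by (simp add: somos4_window_def Let_def)
qed

lemma somos4_window_pred:
  assumes "n \<le> 1"
  shows "somos4_window (n - 1) =
    somos4_bwd (to_fract var_alpha) (to_fract var_beta) (somos4_window n)"
proof -
  have "nat (2 - n) = Suc (nat (1 - n))" using assms by linarith
  then show ?thesis using assms by (cases "n = 1") (simp_all add: somos4_window_def Let_def)
qed

lemma somos4_window_pos:
  "case somos4_window n of (w, x, y, z) \<Rightarrow>
     pos_at_ones w \<and> pos_at_ones x \<and> pos_at_ones y \<and> pos_at_ones z"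
    (is "?P (somos4_window n)")
proof (induction n rule: int_induct[where k = 1])
  case base
  show ?case by (simp add: somos4_window_def pos_at_ones_to_fract)
next
  case (step1 i)
  have "?P s \<Longrightarrow> ?P (somos4_fwd (to_fract var_alpha) (to_fract var_beta) s)" for s
    by (cases s) (auto simp: power2_eq_square intro!: pos_at_ones_ops pos_at_ones_to_fract)
  then show ?case using step1 by (simp only: somos4_window_Suc)
next
  case (step2 i)
  have "?P s \<Longrightarrow> ?P (somos4_bwd (to_fract var_alpha) (to_fract var_beta) s)" for s
    by (cases s) (auto simp: power2_eq_square intro!: pos_at_ones_ops pos_at_ones_to_fract)
  then show ?case using step2 by (simp only: somos4_window_pred)
qed

lemma somos4_formal_nonzero: "somos4_formal n \<noteq> 0"
  using somos4_window_pos[of n]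
  by (auto simp: somos4_formal_def split: prod.splits dest!: pos_at_ones_nonzero)

lemma somos4_window_shift:
  "somos4_window (n + 1) = somos4_fwd (to_fract var_alpha) (to_fract var_beta) (somos4_window n)"
proof (cases "n \<ge> 1")
  case True
  then show ?thesis by (rule somos4_window_Suc)
next
  case False
  obtain w x y z where s: "somos4_window (n + 1) = (w, x, y, z)" by (metis prod_cases4)
  let ?v = "(to_fract var_alpha * y * w + to_fract var_beta * x\<^sup>2) / z"
  have z: "z \<noteq> 0" using somos4_window_pos[of "n + 1"] s by (simp add: pos_at_ones_nonzero)
  have n: "somos4_window n = (?v, w, x, y)"
    using somos4_window_pred[of "n + 1"] False s by simp
  then have v: "?v \<noteq> 0"
    using somos4_window_pos[of n] pos_at_ones_nonzero[of ?v] by (simp only: prod.case) blast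
  have "(to_fract var_alpha * y * w + to_fract var_beta * x\<^sup>2) / ?v = z"
    using v z by (simp add: divide_simps)
  then show ?thesis using s n by (simp del: divide_divide_eq_right)
qed

lemma somos4_window_eq:
  "somos4_window n =
     (somos4_formal n, somos4_formal (n + 1), somos4_formal (n + 2), somos4_formal (n + 3))"
proof -
  obtain w x y z where s: "somos4_window n = (w, x, y, z)" by (metis prod_cases4)
  have fst_snd: "somos4_formal (k + 1) = fst (snd (somos4_window k))"
    "snd (somos4_window (k + 1)) = (case somos4_window k of (w, x, y, z) \<Rightarrow>
       (y, z, (to_fract var_alpha * z * x + to_fract var_beta * y\<^sup>2) / w))" for k
    by (cases "somos4_window k"; simp add: somos4_formal_def somos4_window_shift)+
  have "somos4_formal (n + 2) = y"
    using fst_snd(1)[of "n + 1"] fst_snd(2)[of n] s by (simp add: add.commute)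
  moreover have "somos4_formal (n + 3) = z"
    using fst_snd(1)[of "n + 2"] fst_snd(2)[of "n + 1"] s somos4_window_shift[of n]
    by (simp add: add.commute)
  ultimately show ?thesis
    using s fst_snd(1)[of n] by (simp add: somos4_formal_def)
qed

lemma somos4_formal_initial:
  "somos4_formal 1 = to_fract var_A1" "somos4_formal 2 = to_fract var_A2"
  "somos4_formal 3 = to_fract var_A3" "somos4_formal 4 = to_fract var_A4"
  using somos4_window_eq[of 1] by (simp_all add: somos4_window_def)

lemma somos4_formal_recurrence:
  "somos4_formal (n + 4) * somos4_formal n =
     to_fract var_alpha * somos4_formal (n + 3) * somos4_formal (n + 1)
     + to_fract var_beta * (somos4_formal (n + 2))\<^sup>2"
  using somos4_window_shift[of n] somos4_formal_nonzero[of n]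
  by (simp add: somos4_window_eq ac_simps)

end

theory Submission
  imports Defs
begin

text \<open>
  A Somos 4 sequence generically has the form \<open>A(n) = C D\<^sup>n \<sigma>(z\<^sub>0 + n z) / \<sigma>(z)^(n\<^sup>2)\<close> for a
  Weierstrass sigma function, and \<open>T\<close> is a conserved quantity of the recurrence. The same elliptic
  curve and the point \<open>z\<close> carry a companion elliptic divisibility sequence
  \<open>W(n) = \<sigma>(n z) / \<sigma>(z)^(n\<^sup>2)\<close>, which satisfies the same recurrence with the same \<open>T\<close> and has
  \<open>W(0) = 0, W(1) = 1, W(2)\<^sup>2 = \<alpha>, W(3) = - \<beta>, W(4) = - W(2) (\<alpha>\<^sup>2 + \<beta> T)\<close>.
  The three-term identity for the sigma function gives the addition formulas

    \<open>A(n+m) A(n-m) = W(m)\<^sup>2 A(n+1) A(n-1) - W(m+1) W(m-1) A(n)\<^sup>2\<close>,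

    \<open>W(2) A(n+m+1) A(n-m) = W(m+1) W(m) A(n+2) A(n-1) - W(m+2) W(m-1) A(n+1) A(n)\<close>.

  With \<open>n - m = 1\<close> they express \<open>A(1) A(k)\<close> for \<open>k \<ge> 5\<close> by earlier terms, with coefficients that are
  products of early terms of \<open>W\<close>, divided by \<open>W(2)\<close> in the second formula. The factor \<open>W(2)\<close> always
  cancels, so that the only division is by \<open>A(1)\<close>: all \<open>A(n)\<close> with \<open>n \<ge> 1\<close> are polynomials in
  \<open>\<alpha>, \<beta>, \<beta> T, A(1), 1/A(1), A(2), A(3), A(4)\<close>, once the coefficients are known to be polynomials in
  \<open>\<alpha>, \<beta>, \<beta> T\<close>. For this the same argument applies to \<open>W\<close>, which obeys its own addition formulas and has
  \<open>W(1) = 1\<close>. The backward half is the forward half for the reversed sequence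
  \<open>A(1), A(0), A(-1), A(-2), \<dots>\<close>, which has the same \<open>T\<close>.
\<close>

text \<open>
  The addition formulas are proved without sigma functions. Consecutive ones multiply to each other, since
  \<open>(A(n+m+1) A(n-m-1)) (A(n+m) A(n-m)) = (A(n+m+1) A(n-m)) (A(n+m) A(n-m-1))\<close>
  and similarly for the other kind. So they follow by induction on \<open>m\<close> (\<open>addition_formulas\<close>) from two
  polynomial identities (\<open>odd_addition_step\<close>, \<open>even_addition_step\<close>), provided that the factor to be
  cancelled is non-zero. This is why the argument is carried out in the field of rational functions, where
  the formal sequence has no zeros. Integrality over a subring is \<open>alternating_somos4_in_subring\<close>; it is
  applied to the subring of the rational functions with an integer value at the given data.
\<close>

text \<open>
  To avoid the square root \<open>W(2)\<close>, the companion is normalised to \<open>w(n) = W(n)\<close> for odd \<open>n\<close> and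
  \<open>w(n) = W(n) / W(2)\<close> for even \<open>n\<close>. Then \<open>w\<close> satisfies a Somos 4 recurrence whose first coefficient alternates
  between \<open>1\<close> and \<open>\<alpha>\<^sup>2\<close>. Hence the theory is developed for recurrences whose first coefficient alternates
  between \<open>p\<close> and \<open>q\<close>: the original sequence has \<open>p = q = \<alpha>\<close>, the companion has \<open>p = 1\<close> and
  \<open>q = \<alpha>\<^sup>2\<close>, and only the common product \<open>\<delta> = p q = \<alpha>\<^sup>2\<close> links the two.
\<close>

section \<open>Somos 4 sequences with alternating coefficient\<close>

text \<open>
  Conservation of \<open>T\<close> along the sequence, in the form of a relation between five consecutive terms: the
  defects of this relation in two overlapping windows are proportional. The coefficients \<open>l\<close> and \<open>l'\<close>
  change places from one window to the next, as an alternating coefficient does.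
\<close>

lemma invariant_transport:
  fixes b0 b1 b2 b3 b4 b5 l l' \<beta> T :: "'a::field"
  assumes "b4 * b0 = l * b3 * b1 + \<beta> * b2\<^sup>2"
    and "b5 * b1 = l' * b4 * b2 + \<beta> * b3\<^sup>2"
  shows "b4 * (b4 * b1\<^sup>2 + b3\<^sup>2 * b0 + l' * b2^3 - T * b1 * b2 * b3)
       = b1 * (b5 * b2\<^sup>2 + b4\<^sup>2 * b1 + l * b3^3 - T * b2 * b3 * b4)"
  using assms by algebra

definition alternate :: "'a \<Rightarrow> 'a \<Rightarrow> nat \<Rightarrow> 'a" where
  "alternate p q n = (if even n then p else q)"

lemma alternate_0 [simp]: "alternate p q 0 = p"
  and alternate_Suc [simp]: "alternate p q (Suc n) = alternate q p n"
  by (simp_all add: alternate_def)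

text \<open>
  The term \<open>B 0\<close> may vanish, so that companion sequences are included.
\<close>

locale alternating_somos4 =
  fixes p q \<beta> T :: "'a::field" and B :: "nat \<Rightarrow> 'a"
  assumes nonzero: "n \<ge> 1 \<Longrightarrow> B n \<noteq> 0"
    and recurrence:
      "B (n + 4) * B n = alternate p q n * B (n + 3) * B (n + 1) + \<beta> * (B (n + 2))\<^sup>2"
    and invariant:
      "B (n + 4) * (B (n + 1))\<^sup>2 + (B (n + 3))\<^sup>2 * B n + alternate p q (n + 1) * B (n + 2)^3
       = T * B (n + 1) * B (n + 2) * B (n + 3)"
begin

text \<open>
  Multiplied by \<open>B n\<close>, the five-term relation no longer involves \<open>B (n + 4)\<close> and becomes the definition
  of \<open>T\<close> by four consecutive terms.
\<close>

lemma invariant4: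
  "(B n)\<^sup>2 * (B (n + 3))\<^sup>2 + alternate p q n * B (n + 1)^3 * B (n + 3)
     + alternate p q (n + 1) * B n * B (n + 2)^3 + \<beta> * (B (n + 1))\<^sup>2 * (B (n + 2))\<^sup>2
   = T * B n * B (n + 1) * B (n + 2) * B (n + 3)"
  using recurrence[of n] invariant[of n] by algebra

end

lemma alternating_somos4I:
  fixes p q \<beta> T :: "'a::field"
  assumes nz: "\<And>n. n \<ge> 1 \<Longrightarrow> B n \<noteq> 0"
    and rec: "\<And>n. B (n + 4) * B n
                = alternate p q n * B (n + 3) * B (n + 1) + \<beta> * (B (n + 2))\<^sup>2"
    and inv: "B 4 * (B 1)\<^sup>2 + (B 3)\<^sup>2 * B 0 + q * B 2^3 = T * B 1 * B 2 * B 3"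
  shows "alternating_somos4 p q \<beta> T B"
proof
  fix n
  show "B (n + 4) * (B (n + 1))\<^sup>2 + (B (n + 3))\<^sup>2 * B n + alternate p q (n + 1) * B (n + 2)^3
       = T * B (n + 1) * B (n + 2) * B (n + 3)"
  proof (induction n)
    case 0
    then show ?case using inv by (simp add: alternate_def flip: numeral_2_eq_2)
  next
    case (Suc n)
    have shift: "n + 1 + 1 = n + 2" "n + 1 + 2 = n + 3" "n + 1 + 3 = n + 4" "n + 1 + 4 = n + 5"
      by simp_all
    show ?case
      using invariant_transport[OF rec[of n] rec[of "n + 1", unfolded shift], of T] Suc nz[of "n + 1"]
      unfolding Suc_eq_plus1 shift by (simp add: alternate_def)
  qed
qed (fact nz rec)+

section \<open>The companion sequence and the addition formulas\<close>

text \<open>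
  In both steps the \<open>b\<close>'s are consecutive terms of the sequence and the \<open>w\<close>'s of the companion. The factors
  \<open>c, c', d, d'\<close> are \<open>1\<close> or one of the alternating coefficients; keeping them as variables treats the two
  parities at once. Expanding the left-hand side below gives \<open>b4 b0\<close> and \<open>b3\<^sup>2 b0 + b4 b1\<^sup>2\<close>, which the
  recurrence and the conserved quantity turn into \<open>b3 b1\<close> and \<open>b2\<^sup>2\<close>. Both sides are then quadratic forms
  in \<open>b3 b1\<close> and \<open>b2\<^sup>2\<close>, and the middle coefficients agree by the four-term relation for the companion.
\<close>

lemma odd_addition_step:
  fixes b0 :: "'a::field"
  assumes S: "b4 * b0 = (c * c') * b3 * b1 + \<beta> * b2\<^sup>2"
    and I: "b4 * b1\<^sup>2 + b3\<^sup>2 * b0 + (d * d') * b2^3 = T * b1 * b2 * b3"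
    and W: "w0\<^sup>2 * w3\<^sup>2 + (c * d') * w1^3 * w3 + (c' * d) * w0 * w2^3 + \<beta> * w1\<^sup>2 * w2\<^sup>2
            = T * w0 * w1 * w2 * w3"
  shows "(w2 * w1 * b3 * b0 - w3 * w0 * b2 * b1) * (w2 * w1 * b4 * b1 - w3 * w0 * b3 * b2)
       = (c * w1\<^sup>2 * b3 * b1 - d * w2 * w0 * b2\<^sup>2) * (c' * w2\<^sup>2 * b3 * b1 - d' * w3 * w1 * b2\<^sup>2)"
  using assms by algebra

text \<open>
  Here the sequences change roles: the conserved quantity of \<open>b\<close> makes both sides quadratic forms in
  \<open>b3 b0\<close> and \<open>b2 b1\<close>, and recurrence and conserved quantity of the companion match the coefficients.
\<close>

lemma even_addition_step:
  fixes b0 :: "'a::field"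
  assumes S: "w4 * w0 = (d * d') * w3 * w1 + \<beta> * w2\<^sup>2"
    and I: "w4 * w1\<^sup>2 + w3\<^sup>2 * w0 + (c * c') * w2^3 = T * w1 * w2 * w3"
    and B: "b0\<^sup>2 * b3\<^sup>2 + (d * c') * b1^3 * b3 + (c * d') * b0 * b2^3 + \<beta> * b1\<^sup>2 * b2\<^sup>2
            = T * b0 * b1 * b2 * b3"
  shows "(c * w2\<^sup>2 * b2 * b0 - d * w3 * w1 * b1\<^sup>2) * (c' * w2\<^sup>2 * b3 * b1 - d' * w3 * w1 * b2\<^sup>2)
       = (w2 * w1 * b3 * b0 - w3 * w0 * b2 * b1) * (w3 * w2 * b3 * b0 - w4 * w1 * b2 * b1)"
  using assms by algebra

locale somos4_companion =
  W: alternating_somos4 1 \<delta> \<beta> T w for \<delta> \<beta> T :: "'a::field" and w :: "nat \<Rightarrow> 'a" +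
  assumes w0: "w 0 = 0" and w1: "w 1 = 1" and w2: "w 2 = 1"
begin

text \<open>
  The index \<open>k\<close> is the smaller of the two on the left, and \<open>m = j + 1\<close> is half the distance, rounded down.
  The restriction \<open>k \<ge> 1\<close> keeps the cancelled factors away from \<open>B 0\<close>. In the first formula the alternating
  coefficient replaces the factor \<open>\<alpha> = W(2)\<^sup>2\<close> by which a product
  of two even terms of \<open>W\<close> differs from that of the normalised companion; it is attached to whichever product has even indices.
\<close>

lemma addition_formulas:
  assumes "alternating_somos4 p q \<beta> T B" and pq: "p * q = \<delta>"
  shows "\<forall>k\<ge>1. B (k + 2 * j + 2) * B k
      = (if even j then 1 else alternate p q k) * (w (j + 1))\<^sup>2 * B (k + j + 2) * B (k + j)
      - (if even j then alternate p q k else 1) * w (j + 2) * w j * (B (k + j + 1))\<^sup>2" (is "?F j")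
    and "\<forall>k\<ge>1. B (k + 2 * j + 3) * B k
      = w (j + 2) * w (j + 1) * B (k + j + 3) * B (k + j)
      - w (j + 3) * w j * B (k + j + 2) * B (k + j + 1)" (is "?G j")
proof -
  interpret B: alternating_somos4 p q \<beta> T B by fact
  \<comment> \<open>The order is first formula, second formula, next \<open>j\<close>: each step divides a product of two
    neighbouring instances of the formula before it by the one before that.\<close>
  have "?F j \<and> ?G j"
  proof (induction j)
    case 0
    show ?case using w0 w1 w2 by (simp add: numeral_2_eq_2)
  next
    case (Suc j)
    have F: "?F (Suc j)"
    proof (intro allI impI)
      fix k :: nat assume k: "k \<ge> 1"
      define c where "c = (if even j then 1 else alternate p q (k + 1))"
      define d where "d = (if even j then alternate p q (k + 1) else 1)"
      define c' where "c' = (if even (Suc j) then 1 else alternate p q k)"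
      define d' where "d' = (if even (Suc j) then alternate p q k else 1)"
      have S: "B (k + j + 4) * B (k + j)
          = (c * c') * B (k + j + 3) * B (k + j + 1) + \<beta> * (B (k + j + 2))\<^sup>2"
        using B.recurrence[of "k + j"] by (auto simp: c_def c'_def alternate_def)
      have I: "B (k + j + 4) * (B (k + j + 1))\<^sup>2 + (B (k + j + 3))\<^sup>2 * B (k + j)
          + (d * d') * B (k + j + 2)^3 = T * B (k + j + 1) * B (k + j + 2) * B (k + j + 3)"
        using B.invariant[of "k + j"] by (auto simp: d_def d'_def alternate_def)
      have W: "(w j)\<^sup>2 * (w (j + 3))\<^sup>2 + (c * d') * w (j + 1)^3 * w (j + 3)
          + (c' * d) * w j * w (j + 2)^3 + \<beta> * (w (j + 1))\<^sup>2 * (w (j + 2))\<^sup>2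
          = T * w j * w (j + 1) * w (j + 2) * w (j + 3)"
        using W.invariant4[of j] pq
        by (auto simp: c_def c'_def d_def d'_def alternate_def mult.commute)
      have G1: "B (k + 2 * j + 3) * B k
          = w (j + 2) * w (j + 1) * B (k + j + 3) * B (k + j)
          - w (j + 3) * w j * B (k + j + 2) * B (k + j + 1)"
        using Suc k by blast
      have G2: "B (k + 2 * j + 4) * B (k + 1)
          = w (j + 2) * w (j + 1) * B (k + j + 4) * B (k + j + 1)
          - w (j + 3) * w j * B (k + j + 3) * B (k + j + 2)"
        using conjunct2[OF Suc, rule_format, of "k + 1"] by (simp add: eval_nat_numeral)
      have F: "B (k + 2 * j + 3) * B (k + 1)
          = c * (w (j + 1))\<^sup>2 * B (k + j + 3) * B (k + j + 1)
          - d * w (j + 2) * w j * (B (k + j + 2))\<^sup>2"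
        using conjunct1[OF Suc, rule_format, of "k + 1"]
        by (simp add: eval_nat_numeral c_def d_def)
      have "(B (k + 2 * j + 3) * B (k + 1)) * (B (k + 2 * j + 4) * B k)
          = (B (k + 2 * j + 3) * B k) * (B (k + 2 * j + 4) * B (k + 1))"
        by (simp only: ac_simps)
      also have "\<dots> = (B (k + 2 * j + 3) * B (k + 1)) * (c' * (w (j + 2))\<^sup>2 * B (k + j + 3) * B (k + j + 1)
          - d' * w (j + 3) * w (j + 1) * (B (k + j + 2))\<^sup>2)"
        unfolding G1 G2 F by (rule odd_addition_step[OF S I W])
      finally have "B (k + 2 * j + 4) * B k = c' * (w (j + 2))\<^sup>2 * B (k + j + 3) * B (k + j + 1)
          - d' * w (j + 3) * w (j + 1) * (B (k + j + 2))\<^sup>2"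
        using B.nonzero[of "k + 2 * j + 3"] B.nonzero[of "k + 1"] by simp
      then show "B (k + 2 * Suc j + 2) * B k
        = (if even (Suc j) then 1 else alternate p q k) * (w (Suc j + 1))\<^sup>2
            * B (k + Suc j + 2) * B (k + Suc j)
        - (if even (Suc j) then alternate p q k else 1) * w (Suc j + 2) * w (Suc j)
            * (B (k + Suc j + 1))\<^sup>2"
        unfolding c'_def[symmetric] d'_def[symmetric] by (simp add: eval_nat_numeral)
    qed
    have "?G (Suc j)"
    proof (intro allI impI)
      fix k :: nat assume k: "k \<ge> 1"
      define c where "c = (if even (Suc j) then 1 else alternate p q k)"
      define d where "d = (if even (Suc j) then alternate p q k else 1)"
      define c' where "c' = (if even (Suc j) then 1 else alternate p q (k + 1))"
      define d' where "d' = (if even (Suc j) then alternate p q (k + 1) else 1)"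
      have S: "w (j + 4) * w j = (d * d') * w (j + 3) * w (j + 1) + \<beta> * (w (j + 2))\<^sup>2"
        using W.recurrence[of j] pq by (auto simp: d_def d'_def alternate_def mult.commute)
      have I: "w (j + 4) * (w (j + 1))\<^sup>2 + (w (j + 3))\<^sup>2 * w j + (c * c') * w (j + 2)^3
          = T * w (j + 1) * w (j + 2) * w (j + 3)"
        using W.invariant[of j] pq by (auto simp: c_def c'_def alternate_def mult.commute)
      have shift: "k + j + 1 + 1 = k + j + 2" "k + j + 1 + 2 = k + j + 3" "k + j + 1 + 3 = k + j + 4"
        by simp_all
      have B: "(B (k + j + 1))\<^sup>2 * (B (k + j + 4))\<^sup>2 + (d * c') * B (k + j + 2)^3 * B (k + j + 4)
          + (c * d') * B (k + j + 1) * B (k + j + 3)^3 + \<beta> * (B (k + j + 2))\<^sup>2 * (B (k + j + 3))\<^sup>2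
          = T * B (k + j + 1) * B (k + j + 2) * B (k + j + 3) * B (k + j + 4)"
        using B.invariant4[of "k + j + 1", unfolded shift]
        by (auto simp: c_def c'_def d_def d'_def alternate_def)
      have F1: "B (k + 2 * j + 4) * B k
          = c * (w (j + 2))\<^sup>2 * B (k + j + 3) * B (k + j + 1)
          - d * w (j + 3) * w (j + 1) * (B (k + j + 2))\<^sup>2"
        using F[rule_format, of k, OF k] unfolding c_def[symmetric] d_def[symmetric]
        by (simp add: eval_nat_numeral)
      have F2: "B (k + 2 * j + 5) * B (k + 1)
          = c' * (w (j + 2))\<^sup>2 * B (k + j + 4) * B (k + j + 2)
          - d' * w (j + 3) * w (j + 1) * (B (k + j + 3))\<^sup>2"
        using F[rule_format, of "k + 1"] unfolding c'_def[symmetric] d'_def[symmetric]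
        by (simp add: eval_nat_numeral)
      have G: "B (k + 2 * j + 4) * B (k + 1)
          = w (j + 2) * w (j + 1) * B (k + j + 4) * B (k + j + 1)
          - w (j + 3) * w j * B (k + j + 3) * B (k + j + 2)"
        using conjunct2[OF Suc, rule_format, of "k + 1"] by (simp add: eval_nat_numeral)
      have "(B (k + 2 * j + 4) * B (k + 1)) * (B (k + 2 * j + 5) * B k)
          = (B (k + 2 * j + 4) * B k) * (B (k + 2 * j + 5) * B (k + 1))"
        by (simp only: ac_simps)
      also have "\<dots> = (B (k + 2 * j + 4) * B (k + 1))
          * (w (j + 3) * w (j + 2) * B (k + j + 4) * B (k + j + 1)
             - w (j + 4) * w (j + 1) * B (k + j + 3) * B (k + j + 2))"
        unfolding F1 F2 G by (rule even_addition_step[OF S I B])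
      finally have "B (k + 2 * j + 5) * B k = w (j + 3) * w (j + 2) * B (k + j + 4) * B (k + j + 1)
             - w (j + 4) * w (j + 1) * B (k + j + 3) * B (k + j + 2)"
        using B.nonzero[of "k + 2 * j + 4"] B.nonzero[of "k + 1"] by simp
      then show "B (k + 2 * Suc j + 3) * B k
        = w (Suc j + 2) * w (Suc j + 1) * B (k + Suc j + 3) * B (k + Suc j)
        - w (Suc j + 3) * w (Suc j) * B (k + Suc j + 2) * B (k + Suc j + 1)"
        by (simp add: eval_nat_numeral)
    qed
    with F show ?case ..
  qed
  then show "?F j" "?G j" by blast+
qed

section \<open>Integrality over a subring\<close>

context
  fixes R :: "'a set"
  assumes one: "1 \<in> R"
    and diff: "\<And>x y. x \<in> R \<Longrightarrow> y \<in> R \<Longrightarrow> x - y \<in> R"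
    and mult: "\<And>x y. x \<in> R \<Longrightarrow> y \<in> R \<Longrightarrow> x * y \<in> R"
begin

text \<open>
  The addition formulas with smallest index \<open>1\<close> reach \<open>B n\<close> from terms near \<open>n / 2\<close>. For \<open>n \<ge> 5\<close> all terms
  used, of the sequence and of the companion, have index between \<open>1\<close> and \<open>n - 1\<close>. The alternating
  coefficient enters at index \<open>1\<close>, hence as \<open>q\<close>.
\<close>

lemma doubling_step:
  assumes B: "alternating_somos4 p q \<beta> T B" "p * q = \<delta>"
    and q: "q \<in> R" and B1: "inverse (B 1) \<in> R" and n: "n \<ge> 5"
    and wR: "\<And>i. 1 \<le> i \<Longrightarrow> i < n \<Longrightarrow> w i \<in> R" and BR: "\<And>i. 1 \<le> i \<Longrightarrow> i < n \<Longrightarrow> B i \<in> R"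
  shows "B n \<in> R"
proof -
  interpret B: alternating_somos4 p q \<beta> T B by fact
  have "B n * B 1 \<in> R"
  proof (cases "odd n")
    case True
    define j where "j = n div 2 - 1"
    have j: "n = 2 * j + 3" using True n unfolding j_def by presburger
    then have "j \<ge> 1" using n by linarith
    then show ?thesis
      using addition_formulas(1)[OF B, of j, rule_format, of 1] j q one n
      by (auto simp: alternate_def power2_eq_square eval_nat_numeral intro!: diff mult wR BR)
  next
    case False
    define j where "j = n div 2 - 2"
    have j: "n = 2 * j + 4" using False n unfolding j_def by presburger
    then have "j \<ge> 1" using n by linarith
    then show ?thesis
      using addition_formulas(2)[OF B, of j, rule_format, of 1] j n
      by (auto simp: eval_nat_numeral intro!: diff mult wR BR)
  qed
  then have "B n * B 1 * inverse (B 1) \<in> R" using B1 by (rule mult)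
  then show ?thesis using B.nonzero[of 1] by (simp add: mult.assoc)
qed

text \<open>
  Here \<open>doubling_step\<close> is applied with the companion in both roles.
\<close>

lemma companion_in_subring:
  assumes "\<delta> \<in> R" "\<beta> \<in> R" "\<beta> * T \<in> R" and "n \<ge> 1"
  shows "w n \<in> R"
  using \<open>n \<ge> 1\<close>
proof (induction n rule: less_induct)
  case (less n)
  have zero: "0 \<in> R" using diff[OF one one] by simp
  have w3: "w 3 = - \<beta>"
    using W.recurrence[of 0] w0 w1 w2
    by (simp add: alternate_def eq_neg_iff_add_eq_0 add.commute flip: numeral_2_eq_2)
  have "w 4 = (0 - \<beta> * T) - \<delta>"
    using W.invariant[of 0] w0 w1 w2 w3 by (simp add: alternate_def algebra_simps eq_neg_iff_add_eq_0 flip: numeral_2_eq_2)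
  then have w4: "w 4 \<in> R" using assms diff zero by metis
  have w3: "w 3 \<in> R" using w3 diff[OF zero assms(2)] by simp
  consider "n = 1" | "n = 2" | "n = 3" | "n = 4" | "n \<ge> 5" using less.prems by linarith
  then show ?case
  proof cases
    case 5
    show ?thesis
      by (rule doubling_step[OF W.alternating_somos4_axioms])
        (use 5 less assms one w1 in simp_all)
  qed (use w1 w2 w3 w4 one in auto)
qed

theorem alternating_somos4_in_subring:
  assumes "alternating_somos4 p q \<beta> T B" "p * q = \<delta>"
    and "q \<in> R" "\<delta> \<in> R" "\<beta> \<in> R" "\<beta> * T \<in> R"
    and "inverse (B 1) \<in> R" and init: "B 1 \<in> R" "B 2 \<in> R" "B 3 \<in> R" "B 4 \<in> R" and "n \<ge> 1"
  shows "B n \<in> R"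
  using \<open>n \<ge> 1\<close>
proof (induction n rule: less_induct)
  case (less n)
  consider "n = 1" | "n = 2" | "n = 3" | "n = 4" | "n \<ge> 5" using less.prems by linarith
  then show ?case
    by cases (use init doubling_step[OF assms(1-3,7)] less companion_in_subring[OF assms(4-6)] in auto)
qed

end

end

section \<open>Values of rational functions\<close>

lemma has_value6_to_fract:
  "has_value6 (to_fract p) \<alpha> \<beta> a1 a2 a3 a4 (of_int (eval6 \<alpha> \<beta> a1 a2 a3 a4 p))"
  unfolding has_value6_def to_fract_def by (intro exI[of _ p] exI[of _ 1]) simp

lemma has_value6_arith:
  assumes "has_value6 r \<alpha> \<beta> a1 a2 a3 a4 v" "has_value6 s \<alpha> \<beta> a1 a2 a3 a4 w"
  shows "has_value6 (r + s) \<alpha> \<beta> a1 a2 a3 a4 (v + w)"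
    and "has_value6 (r - s) \<alpha> \<beta> a1 a2 a3 a4 (v - w)"
    and "has_value6 (r * s) \<alpha> \<beta> a1 a2 a3 a4 (v * w)"
    and "w \<noteq> 0 \<Longrightarrow> has_value6 (r / s) \<alpha> \<beta> a1 a2 a3 a4 (v / w)"
proof -
  let ?e = "eval6 \<alpha> \<beta> a1 a2 a3 a4"
  have e_diff: "?e (x - y) = ?e x - ?e y" for x y
    by (simp add: eval6_def)
  obtain p q p' q' where r: "r = Fract p q" "?e q \<noteq> 0" "v = of_int (?e p) / of_int (?e q)"
    and s: "s = Fract p' q'" "?e q' \<noteq> 0" "w = of_int (?e p') / of_int (?e q')"
    using assms unfolding has_value6_def by blast
  have nz: "q \<noteq> 0" "q' \<noteq> 0" using r s by auto
  show "has_value6 (r + s) \<alpha> \<beta> a1 a2 a3 a4 (v + w)" unfolding has_value6_def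
    by (rule exI[of _ "p * q' + p' * q"], rule exI[of _ "q * q'"])
      (use r s nz in \<open>simp add: add_frac_eq\<close>)
  show "has_value6 (r - s) \<alpha> \<beta> a1 a2 a3 a4 (v - w)" unfolding has_value6_def
    by (rule exI[of _ "p * q' - p' * q"], rule exI[of _ "q * q'"])
      (use r s nz in \<open>simp add: e_diff diff_frac_eq\<close>)
  show "has_value6 (r * s) \<alpha> \<beta> a1 a2 a3 a4 (v * w)" unfolding has_value6_def
    by (rule exI[of _ "p * p'"], rule exI[of _ "q * q'"]) (use r s in simp)
  show "has_value6 (r / s) \<alpha> \<beta> a1 a2 a3 a4 (v / w)" if "w \<noteq> 0" unfolding has_value6_def
    by (rule exI[of _ "p * q'"], rule exI[of _ "q * p'"]) (use r s that in simp)
qed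

lemma somos4_eqI: "has_value6 (somos4_formal n) \<alpha> \<beta> a1 a2 a3 a4 v \<Longrightarrow> somos4 \<alpha> \<beta> a1 a2 a3 a4 n = v"
  unfolding somos4_def by (rule the_equality) (auto intro: has_value6_unique)

section \<open>The formal sequence and its companion\<close>

definition formal_T :: "zpoly6 fract" where
  "formal_T = to_fract (var_A1\<^sup>2 * var_A4\<^sup>2 + var_alpha * (var_A2^3 * var_A4 + var_A1 * var_A3^3)
                + var_beta * var_A2\<^sup>2 * var_A3\<^sup>2) / to_fract (var_A1 * var_A2 * var_A3 * var_A4)"

lemma has_value6_formal_T:
  assumes "a1 \<noteq> 0" "a2 \<noteq> 0" "a3 \<noteq> 0" "a4 \<noteq> 0"
  shows "has_value6 formal_T \<alpha> \<beta> a1 a2 a3 a4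
    (of_int (a1\<^sup>2 * a4\<^sup>2 + \<alpha> * (a2^3 * a4 + a1 * a3^3) + \<beta> * a2\<^sup>2 * a3\<^sup>2)
       / of_int (a1 * a2 * a3 * a4))"
proof -
  let ?p = "var_A1\<^sup>2 * var_A4\<^sup>2 + var_alpha * (var_A2^3 * var_A4 + var_A1 * var_A3^3)
    + var_beta * var_A2\<^sup>2 * var_A3\<^sup>2" and ?q = "var_A1 * var_A2 * var_A3 * var_A4"
  have "has_value6 (to_fract ?p / to_fract ?q) \<alpha> \<beta> a1 a2 a3 a4
      (of_int (eval6 \<alpha> \<beta> a1 a2 a3 a4 ?p) / of_int (eval6 \<alpha> \<beta> a1 a2 a3 a4 ?q))"
    by (rule has_value6_arith(4)[OF has_value6_to_fract has_value6_to_fract])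
      (use assms in simp)
  then show ?thesis by (simp only: formal_T_def eval6_simps eval6_vars)
qed

text \<open>
  The window starting at \<open>1\<close> satisfies the five-term relation by the choice of \<open>formal_T\<close>, and
  \<open>invariant_transport\<close> carries it in both directions because the formal terms are non-zero.
\<close>

lemma formal_invariant:
  "somos4_formal (n + 4) * (somos4_formal (n + 1))\<^sup>2
     + (somos4_formal (n + 3))\<^sup>2 * somos4_formal n
     + to_fract var_alpha * somos4_formal (n + 2)^3
   = formal_T * somos4_formal (n + 1) * somos4_formal (n + 2) * somos4_formal (n + 3)"
    (is "?I n")
proof -
  let ?A = somos4_formal
  have transport: "?I n \<longleftrightarrow> ?I (n + 1)" for n
  proof -
    have shift: "n + 1 + 1 = n + 2" "n + 1 + 2 = n + 3" "n + 1 + 3 = n + 4" "n + 1 + 4 = n + 5"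
      by simp_all
    show ?thesis
      using invariant_transport[OF somos4_formal_recurrence[of n]
          somos4_formal_recurrence[of "n + 1", unfolded shift], of formal_T]
        somos4_formal_nonzero[of "n + 4"] somos4_formal_nonzero[of "n + 1"]
      unfolding shift by auto
  qed
  have "formal_T * (?A 1 * ?A 2 * ?A 3 * ?A 4)
      = (?A 1)\<^sup>2 * (?A 4)\<^sup>2 + to_fract var_alpha * (?A 2^3 * ?A 4 + ?A 1 * ?A 3^3)
        + to_fract var_beta * (?A 2)\<^sup>2 * (?A 3)\<^sup>2"
    using somos4_formal_nonzero[of 1] somos4_formal_nonzero[of 2]
      somos4_formal_nonzero[of 3] somos4_formal_nonzero[of 4]
    unfolding formal_T_def somos4_formal_initial
    by (simp add: power2_eq_square power3_eq_cube)
  then have "?A 1 * (?A 5 * (?A 2)\<^sup>2 + (?A 4)\<^sup>2 * ?A 1 + to_fract var_alpha * ?A 3^3)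
      = ?A 1 * (formal_T * ?A 2 * ?A 3 * ?A 4)"
    using somos4_formal_recurrence[of 1] by simp algebra
  then have base: "?I 1"
    using somos4_formal_nonzero[of 1] by simp
  show ?thesis
  proof (induction n rule: int_induct[where k = 1])
    case base
    show ?case by fact
  next
    case (step1 i)
    then show ?case using transport by blast
  next
    case (step2 i)
    then show ?case using transport[of "i - 1"] by simp
  qed
qed

lemma formal_forward:
  "alternating_somos4 (to_fract var_alpha) (to_fract var_alpha) (to_fract var_beta) formal_T
     (\<lambda>k. somos4_formal (int k))"
proof
  fix k :: nat
  show "somos4_formal (int k) \<noteq> 0"
    by (rule somos4_formal_nonzero)
  show "somos4_formal (int (k + 4)) * somos4_formal (int k)
      = alternate (to_fract var_alpha) (to_fract var_alpha) k * somos4_formal (int (k + 3))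
          * somos4_formal (int (k + 1))
        + to_fract var_beta * (somos4_formal (int (k + 2)))\<^sup>2"
    using somos4_formal_recurrence[of "int k"] by (simp add: alternate_def ac_simps)
  show "somos4_formal (int (k + 4)) * (somos4_formal (int (k + 1)))\<^sup>2
      + (somos4_formal (int (k + 3)))\<^sup>2 * somos4_formal (int k)
      + alternate (to_fract var_alpha) (to_fract var_alpha) (k + 1) * somos4_formal (int (k + 2))^3
      = formal_T * somos4_formal (int (k + 1)) * somos4_formal (int (k + 2))
        * somos4_formal (int (k + 3))"
    using formal_invariant[of "int k"] by (simp add: alternate_def ac_simps)
qed

text \<open>
  Recurrence and conserved quantity are invariant under reversal of the sequence. The reflection
  \<open>k \<mapsto> 2 - k\<close> fixes the index \<open>1\<close>, the one term by which division is harmless.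
\<close>

lemma formal_backward:
  "alternating_somos4 (to_fract var_alpha) (to_fract var_alpha) (to_fract var_beta) formal_T
     (\<lambda>k. somos4_formal (2 - int k))"
proof
  fix k :: nat
  have shift: "- 2 - int k + 4 = 2 - int k" "- 2 - int k + 3 = 2 - int (k + 1)"
    "- 2 - int k + 2 = 2 - int (k + 2)" "- 2 - int k + 1 = 2 - int (k + 3)"
    "- 2 - int k = 2 - int (k + 4)"
    by simp_all
  show "somos4_formal (2 - int k) \<noteq> 0"
    by (rule somos4_formal_nonzero)
  show "somos4_formal (2 - int (k + 4)) * somos4_formal (2 - int k)
      = alternate (to_fract var_alpha) (to_fract var_alpha) k * somos4_formal (2 - int (k + 3))
          * somos4_formal (2 - int (k + 1))
        + to_fract var_beta * (somos4_formal (2 - int (k + 2)))\<^sup>2"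
    using somos4_formal_recurrence[of "- 2 - int k"]
    unfolding shift(1-4) unfolding shift(5) by (simp only: alternate_def if_cancel ac_simps)
  show "somos4_formal (2 - int (k + 4)) * (somos4_formal (2 - int (k + 1)))\<^sup>2
      + (somos4_formal (2 - int (k + 3)))\<^sup>2 * somos4_formal (2 - int k)
      + alternate (to_fract var_alpha) (to_fract var_alpha) (k + 1)
        * somos4_formal (2 - int (k + 2))^3
      = formal_T * somos4_formal (2 - int (k + 1)) * somos4_formal (2 - int (k + 2))
        * somos4_formal (2 - int (k + 3))"
    using formal_invariant[of "- 2 - int k"]
    unfolding shift(1-4) unfolding shift(5) by (simp only: alternate_def if_cancel ac_simps)
qed

text \<open>
  The fourth value is forced by the five-term relation in the window starting at \<open>0\<close>. As \<open>companion \<delta> \<beta> T 0\<close>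
  vanishes, the recurrence determines terms only from the fifth on.
\<close>

fun companion :: "'a \<Rightarrow> 'a \<Rightarrow> 'a \<Rightarrow> nat \<Rightarrow> 'a::field" where
  "companion \<delta> \<beta> T 0 = 0"
| "companion \<delta> \<beta> T (Suc 0) = 1"
| "companion \<delta> \<beta> T (Suc (Suc 0)) = 1"
| "companion \<delta> \<beta> T (Suc (Suc (Suc 0))) = - \<beta>"
| "companion \<delta> \<beta> T (Suc (Suc (Suc (Suc 0)))) = - (\<delta> + \<beta> * T)"
| "companion \<delta> \<beta> T (Suc (Suc (Suc (Suc (Suc n))))) =
     (alternate \<delta> 1 n * companion \<delta> \<beta> T (Suc (Suc (Suc (Suc n)))) * companion \<delta> \<beta> T (Suc (Suc n))
       + \<beta> * (companion \<delta> \<beta> T (Suc (Suc (Suc n))))\<^sup>2) / companion \<delta> \<beta> T (Suc n)"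

lemma somos4_companion_companion:
  assumes "\<And>n. n \<ge> 1 \<Longrightarrow> companion \<delta> \<beta> T n \<noteq> 0"
  shows "somos4_companion \<delta> \<beta> T (companion \<delta> \<beta> T)"
proof -
  have "alternating_somos4 1 \<delta> \<beta> T (companion \<delta> \<beta> T)"
  proof (rule alternating_somos4I)
    fix n
    show "companion \<delta> \<beta> T (n + 4) * companion \<delta> \<beta> T n
        = alternate 1 \<delta> n * companion \<delta> \<beta> T (n + 3) * companion \<delta> \<beta> T (n + 1)
          + \<beta> * (companion \<delta> \<beta> T (n + 2))\<^sup>2"
    proof (cases n)
      case 0
      then show ?thesis by (simp add: numeral_eq_Suc)
    next
      case (Suc m)
      then show ?thesis using assms[of n] by (simp add: numeral_eq_Suc)
    qed
  qed (use assms in \<open>simp_all add: numeral_eq_Suc algebra_simps\<close>)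
  then show ?thesis
    by (simp add: somos4_companion_def somos4_companion_axioms_def numeral_2_eq_2)
qed

text \<open>
  The formal companion has no zeros beyond index \<open>0\<close>, because it specialises to a sequence without them: the
  degenerate elliptic divisibility sequence \<open>W(n) = n\<close>, which belongs to \<open>\<alpha> = 4, \<beta> = -3, T = 6\<close>. The data
  \<open>1, 2, 3, 4\<close> have \<open>T = 6\<close> for these \<open>\<alpha>\<close> and \<open>\<beta>\<close>. Dividing by \<open>W(2) = 2\<close> at even indices gives the values below.
\<close>

lemma companion_value:
  assumes \<delta>: "has_value6 \<delta> 4 (-3) 1 2 3 4 16"
    and \<beta>: "has_value6 \<beta> 4 (-3) 1 2 3 4 (-3)"
    and T: "has_value6 T 4 (-3) 1 2 3 4 6"
  shows "has_value6 (companion \<delta> \<beta> T n) 4 (-3) 1 2 3 4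
           (if even n then of_nat n / 2 else of_nat n)"
  using assms
proof (induction \<delta> \<beta> T n rule: companion.induct)
  case (6 \<delta> \<beta> T n)
  have one: "has_value6 1 4 (-3) 1 2 3 4 1"
    using has_value6_to_fract[of 1] by simp
  note IH = "6.IH"[OF "6.prems"]
  let ?v = "\<lambda>n. if even n then of_nat n / 2 else of_nat n :: rat"
  have l: "has_value6 (alternate \<delta> 1 n) 4 (-3) 1 2 3 4 (alternate 16 1 n)"
    using "6.prems"(1) one by (simp add: alternate_def)
  have "has_value6 (companion \<delta> \<beta> T (Suc (Suc (Suc (Suc (Suc n)))))) 4 (-3) 1 2 3 4
     ((alternate 16 1 n * ?v (Suc (Suc (Suc (Suc n)))) * ?v (Suc (Suc n))
       + (-3) * (?v (Suc (Suc (Suc n))) * ?v (Suc (Suc (Suc n))))) / ?v (Suc n))"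
    unfolding companion.simps power2_eq_square
    by (intro has_value6_arith l IH "6.prems") auto
  moreover have "(alternate 16 1 n * ?v (Suc (Suc (Suc (Suc n)))) * ?v (Suc (Suc n))
       + (-3) * (?v (Suc (Suc (Suc n))) * ?v (Suc (Suc (Suc n))))) / ?v (Suc n)
       = ?v (Suc (Suc (Suc (Suc (Suc n)))))"
    by (auto simp: alternate_def field_simps)
  ultimately show ?case by simp
next
  case 1
  show ?case using has_value6_to_fract[of 0] by simp
next
  case 2
  show ?case using has_value6_to_fract[of 1] by simp
next
  case 3
  show ?case using has_value6_to_fract[of 1] by simp
next
  case (4 \<delta> \<beta> T)
  show ?case using has_value6_arith(2)[OF has_value6_to_fract[of 0] "4.prems"(2)] by simp
next
  case (5 \<delta> \<beta> T)
  show ?case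
    using has_value6_arith(2)[OF has_value6_to_fract[of 0] has_value6_arith(1)[OF "5.prems"(1)
        has_value6_arith(3)[OF "5.prems"(2,3)]]] by simp
qed

lemma somos4_companion_formal:
  "somos4_companion (to_fract var_alpha * to_fract var_alpha) (to_fract var_beta) formal_T
     (companion (to_fract var_alpha * to_fract var_alpha) (to_fract var_beta) formal_T)"
proof (rule somos4_companion_companion)
  let ?a = "to_fract var_alpha" and ?b = "to_fract var_beta"
  let ?w = "companion (?a * ?a) ?b formal_T"
  have w_val: "has_value6 (?w n) 4 (-3) 1 2 3 4 (if even n then of_nat n / 2 else of_nat n)" for n
    using companion_value[of "?a * ?a" ?b formal_T n] has_value6_formal_T[of 1 2 3 4 4 "-3"]
      has_value6_arith(3)[OF has_value6_to_fract[of var_alpha 4 "-3" 1 2 3 4]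
        has_value6_to_fract[of var_alpha 4 "-3" 1 2 3 4]]
      has_value6_to_fract[of var_beta 4 "-3" 1 2 3 4]
    by simp
  show "?w n \<noteq> 0" if "n \<ge> 1" for n
  proof
    assume "?w n = 0"
    then have "has_value6 (?w n) 4 (-3) 1 2 3 4 0"
      using has_value6_to_fract[of 0] by simp
    from has_value6_unique[OF this w_val] show False
      using that by (auto split: if_splits)
  qed
qed

text \<open>
  Integrality of the backward iterates says something about the formal sequence only if the formal terms
  have a value there. For the indices \<open>0, -1, -2\<close> this follows from the recurrence, as it divides by
  \<open>A\<^sub>4, A\<^sub>3, A\<^sub>2\<close> only.
\<close>

lemma formal_predecessor_has_value:
  assumes "has_value6 (somos4_formal (n + 1)) \<alpha> \<beta> a1 a2 a3 a4 v1"
    and "has_value6 (somos4_formal (n + 2)) \<alpha> \<beta> a1 a2 a3 a4 v2"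
    and "has_value6 (somos4_formal (n + 3)) \<alpha> \<beta> a1 a2 a3 a4 v3"
    and "has_value6 (somos4_formal (n + 4)) \<alpha> \<beta> a1 a2 a3 a4 v4" and "v4 \<noteq> 0"
  shows "\<exists>v. has_value6 (somos4_formal n) \<alpha> \<beta> a1 a2 a3 a4 v"
proof -
  have "somos4_formal n
      = (to_fract var_alpha * somos4_formal (n + 3) * somos4_formal (n + 1)
          + to_fract var_beta * (somos4_formal (n + 2) * somos4_formal (n + 2)))
        / somos4_formal (n + 4)"
    using somos4_formal_recurrence[of n] somos4_formal_nonzero[of "n + 4"]
    by (simp add: field_simps power2_eq_square)
  then show ?thesis
    using assms by (metis has_value6_arith(1,3,4) has_value6_to_fract)
qed

theorem corollary3p2:
  fixes \<alpha> \<beta> A1 A2 A3 A4 :: int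
    and A :: "int \<Rightarrow> rat"
    and T :: rat
  assumes "A1 \<in> {1, -1}" and "A2 \<noteq> 0" and "A3 \<noteq> 0" and "A4 \<noteq> 0"
    and A_eq: "A = somos4 \<alpha> \<beta> A1 A2 A3 A4"
    and T_eq: "T = of_int (A1\<^sup>2 * A4\<^sup>2 + \<alpha> * (A2^3 * A4 + A1 * A3^3) + \<beta> * A2\<^sup>2 * A3\<^sup>2)
                   / of_int (A1 * A2 * A3 * A4)"
    and "of_int \<beta> * T \<in> \<int>"
  shows "(\<forall>n\<ge>1. A n \<in> \<int>) \<and>
         (A 0 \<in> \<int> \<and> A (-1) \<in> \<int> \<and> A (-2) \<in> \<int> \<longrightarrow> (\<forall>n. A n \<in> \<int>))"
proof -
  let ?a = "to_fract var_alpha" and ?b = "to_fract var_beta"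
  interpret somos4_companion "?a * ?a" ?b formal_T "companion (?a * ?a) ?b formal_T"
    by (rule somos4_companion_formal)

  let ?val = "\<lambda>r. has_value6 r \<alpha> \<beta> A1 A2 A3 A4"
  define R where "R = {r. \<exists>v\<in>\<int>. ?val r v}"
  have R_I: "r \<in> R" if "?val r v" "v \<in> \<int>" for r v
    using that unfolding R_def by blast
  have poly_R: "to_fract p \<in> R" for p
    by (rule R_I[OF has_value6_to_fract]) simp
  have one_R: "1 \<in> R" using poly_R[of 1] by simp
  have diff_R: "x - y \<in> R" if "x \<in> R" "y \<in> R" for x y
    using that has_value6_arith(2) unfolding R_def by (blast intro: Ints_diff)
  have mult_R: "x * y \<in> R" if "x \<in> R" "y \<in> R" for x y
    using that has_value6_arith(3) unfolding R_def by (blast intro: Ints_mult)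
  have "A1 \<noteq> 0" using assms(1) by auto
  have "?val formal_T T"
    unfolding T_eq by (rule has_value6_formal_T) fact+
  then have bT: "?b * formal_T \<in> R"
    using R_I[OF has_value6_arith(3)[OF has_value6_to_fract[of var_beta]]] assms(7) by simp
  have "?val (1 / to_fract var_A1) (1 / of_int A1)"
    using has_value6_arith(4)[OF has_value6_to_fract[of 1] has_value6_to_fract[of var_A1],
        of \<alpha> \<beta> A1 A2 A3 A4] \<open>A1 \<noteq> 0\<close> by simp
  then have inv_R: "inverse (somos4_formal 1) \<in> R"
    using R_I assms(1) by (auto simp: somos4_formal_initial inverse_eq_divide)
  have A_int: "A n \<in> \<int>" if "somos4_formal n \<in> R" for n
    using that somos4_eqI unfolding R_def A_eq by blast
  have integral: "B n \<in> R"
    if "alternating_somos4 ?a ?a ?b formal_T B" "B 1 = somos4_formal 1"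
      "B 2 \<in> R" "B 3 \<in> R" "B 4 \<in> R" "n \<ge> 1" for B n
    by (rule alternating_somos4_in_subring[OF one_R diff_R mult_R that(1)])
      (use that poly_R mult_R bT inv_R in \<open>auto simp: somos4_formal_initial\<close>)

  have fwd: "somos4_formal n \<in> R" if "n \<ge> 1" for n
    using integral[OF formal_forward, of "nat n"] that poly_R by (simp add: somos4_formal_initial)

  have bwd: "somos4_formal n \<in> R" if "A 0 \<in> \<int>" "A (-1) \<in> \<int>" "A (-2) \<in> \<int>" "n \<le> 1" for n
  proof -
    have init: "?val (somos4_formal 1) (of_int A1)" "?val (somos4_formal 2) (of_int A2)"
      "?val (somos4_formal 3) (of_int A3)" "?val (somos4_formal 4) (of_int A4)"
      using has_value6_to_fract[of _ \<alpha> \<beta> A1 A2 A3 A4] unfolding somos4_formal_initial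
      by (metis eval6_vars)+
    obtain v0 where v0: "?val (somos4_formal 0) v0"
      using formal_predecessor_has_value[of 0, simplified, OF init] assms(4) by auto
    obtain v1 where v1: "?val (somos4_formal (-1)) v1"
      using formal_predecessor_has_value[of "-1", simplified, OF v0 init(1-3)] assms(3) by auto
    obtain v2 where v2: "?val (somos4_formal (-2)) v2"
      using formal_predecessor_has_value[of "-2", simplified, OF v1 v0 init(1-2)] assms(2) by auto
    have R: "somos4_formal 0 \<in> R" "somos4_formal (-1) \<in> R" "somos4_formal (-2) \<in> R"
      using that(1-3) v0 v1 v2 R_I somos4_eqI unfolding A_eq by metis+
    show ?thesis
      using integral[OF formal_backward, of "nat (2 - n)"] that(4) R by simp
  qed

  show ?thesis
    using fwd bwd A_int by (meson linorder_le_cases)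
qed

end
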